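(* Let $d>1$. No tight spherical $7$-design in $\mathbb{S}^{d-1}$ (i.e. in $\mathbb{R}^d$) is of minimal type; that is, if $D\subset\mathbb{S}^{d-1}$ is a spherical $7$-design with $|D|=\frac{d(d+1)(d+2)}{3}$, then there is no $\alpha\in\mathbb{R}^d$ with $\langle\alpha,x\rangle\in\{0,\pm1\}$ for all $x\in D$.
   Context: Spherical $7$-design: a finite non-empty $D\subset\mathbb{S}^{d-1}$ with $\int_{\mathbb{S}^{d-1}}f\,d\mu=\frac{1}{|D|}\sum_{x\in D}f(x)$ for all polynomials $f$ of degree $\le 7$ ($\mu$ normalized surface measure); it is tight if $|D|=2\binom{d+2}{3}=\frac{d(d+1)(d+2)}{3}$.
   Formalization: The vector α is required to be nonzero; with α = 0 one has ⟨α,x⟩ = 0 for all x in D, so the claim as written fails for every tight 7-design, e.g. the regular octagon for d = 2. *)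

theory Defs
  imports "HOL-Probability.Probability"
begin

text \<open>
  The library has no surface measure.  We use the polar-coordinate (cone) construction: the
  normalized surface measure of a Borel set \<open>A\<close> of unit vectors is
  \<open>vol {r x | x \<in> A, 0 < r < 1} / vol (ball 0 1)\<close>, i.e. the radial projection of the uniform
  distribution on the unit ball.  It is a measure on the ambient space, concentrated on the unit
  sphere; the origin, where the projection is not defined, is a null set.
\<close>

definition sphere_measure :: "(real ^ 'n) measure" where
  "sphere_measure = distr (uniform_measure lborel (ball 0 1)) borel (\<lambda>x. x /\<^sub>R norm x)"

lemma prob_space_sphere_measure: "prob_space (sphere_measure :: (real ^ 'n) measure)"
proof -
  let ?B = "ball 0 1 :: (real ^ 'n) set"
  have "emeasure lborel ?B \<noteq> 0"
    using open_not_negligible[of ?B] negligible_iff_emeasure0[of ?B] by auto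
  moreover have "emeasure lborel ?B \<noteq> \<infinity>"
    using emeasure_bounded_finite[of ?B] by auto
  ultimately have "prob_space (uniform_measure lborel ?B)"
    by (rule prob_space_uniform_measure)
  then show ?thesis
    unfolding sphere_measure_def by (rule prob_space.prob_space_distr) measurable
qed

lemma AE_sphere_measure: "AE x in (sphere_measure :: (real ^ 'n) measure). x \<in> sphere 0 1"
proof -
  have "AE x in uniform_measure lborel (ball 0 1 :: (real ^ 'n) set). x /\<^sub>R norm x \<in> sphere 0 1"
    by (rule AE_uniform_measureI) (use AE_lborel_singleton[of "0 :: real ^ 'n"] in auto)
  then show ?thesis
    unfolding sphere_measure_def by (subst AE_distr_iff) auto
qed

definition polynomial_of_degree_le :: "nat \<Rightarrow> (real ^ 'n \<Rightarrow> real) \<Rightarrow> bool" where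
  "polynomial_of_degree_le k f \<longleftrightarrow>
     (\<exists>c :: ('n \<Rightarrow> nat) \<Rightarrow> real. \<forall>x. f x = (\<Sum>e | (\<Sum>i\<in>UNIV. e i) \<le> k. c e * (\<Prod>i\<in>UNIV. (x $ i) ^ e i)))"

lemma finite_exponents: "finite {e :: 'n::finite \<Rightarrow> nat. (\<Sum>i\<in>UNIV. e i) \<le> k}"
proof (rule finite_subset)
  show "{e :: 'n \<Rightarrow> nat. (\<Sum>i\<in>UNIV. e i) \<le> k} \<subseteq> Pi\<^sub>E UNIV (\<lambda>_. {..k})"
  proof
    fix e :: "'n \<Rightarrow> nat" assume e: "e \<in> {e. (\<Sum>i\<in>UNIV. e i) \<le> k}"
    have "e i \<le> k" for i
      using member_le_sum[of i UNIV e] e by simp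
    then show "e \<in> Pi\<^sub>E UNIV (\<lambda>_. {..k})" by (simp add: PiE_iff)
  qed
qed (simp add: finite_PiE)

definition spherical_design :: "nat \<Rightarrow> (real ^ 'n) set \<Rightarrow> bool" where
  "spherical_design t D \<longleftrightarrow> finite D \<and> D \<noteq> {} \<and> D \<subseteq> sphere 0 1 \<and>
     (\<forall>f. polynomial_of_degree_le t f \<longrightarrow>
        (\<integral>x. f x \<partial>sphere_measure) = (\<Sum>x\<in>D. f x) / real (card D))"

definition tight_spherical_7_design :: "(real ^ 'n) set \<Rightarrow> bool" where
  "tight_spherical_7_design D \<longleftrightarrow>
     spherical_design 7 D \<and> card D = 2 * ((CARD('n) + 2) choose 3)"

text \<open>
  The vector \<open>\<alpha>\<close> has to be nonzero: \<open>\<alpha> = 0\<close> would make every set \<open>D\<close> of minimal type.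
\<close>

definition minimal_type :: "(real ^ 'n) set \<Rightarrow> bool" where
  "minimal_type D \<longleftrightarrow> (\<exists>\<alpha>. \<alpha> \<noteq> 0 \<and> (\<forall>x\<in>D. \<alpha> \<bullet> x \<in> {0, 1, -1}))"

lemma two_choose_three: "real (2 * ((d + 2) choose 3)) = real d * (real d + 1) * (real d + 2) / 3"
proof (induction d)
  case (Suc d)
  have "(Suc d + 2) choose 3 = ((d + 2) choose 3) + ((d + 2) choose 2)"
    by (simp add: numeral_eq_Suc)
  moreover have "2 * ((d + 2) choose 2) = (d + 2) * (d + 1)"
    by (simp add: choose_two)
  then have "2 * real ((d + 2) choose 2) = (real d + 2) * (real d + 1)"
    by (metis (mono_tags) of_nat_1 of_nat_add of_nat_mult of_nat_numeral)
  ultimately show ?case using Suc by (simp add: field_simps)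
qed (simp add: numeral_eq_Suc)

end

theory Submission
  imports Defs
begin

text \<open>
  If \<open>\<alpha>\<close> takes only the values \<open>0, \<plusminus>1\<close> on \<open>D\<close>, then the nonnegative polynomial
  \<open>(\<alpha> \<bullet> x)\<^sup>2 (1 - (\<alpha> \<bullet> x)\<^sup>2)\<^sup>2\<close>, of degree 6, vanishes on \<open>D\<close>.  By the design property its integral
  over the sphere is \<open>0\<close>, so by continuity it vanishes on the whole sphere.  In dimension at least 2 this
  is absurd, because a nonzero linear form attains a continuum of values on the sphere.
\<close>

lemma polynomial_of_degree_le_monomial:
  assumes "(\<Sum>i\<in>UNIV. e i) \<le> k"
  shows "polynomial_of_degree_le k (\<lambda>x :: real ^ 'n. \<Prod>i\<in>UNIV. (x $ i) ^ e i)"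
proof -
  have "(\<Prod>i\<in>UNIV. (x $ i) ^ e i) = (\<Sum>e' | (\<Sum>i\<in>UNIV. e' i) \<le> k.
      (if e' = e then 1 else 0) * (\<Prod>i\<in>UNIV. (x $ i) ^ e' i))" for x :: "real ^ 'n"
  proof -
    have "(\<Sum>e' | (\<Sum>i\<in>UNIV. e' i) \<le> k. (if e' = e then 1 else 0) * (\<Prod>i\<in>UNIV. (x $ i) ^ e' i))
        = (\<Sum>e' | (\<Sum>i\<in>UNIV. e' i) \<le> k. if e' = e then (\<Prod>i\<in>UNIV. (x $ i) ^ e' i) else 0)"
      by (rule sum.cong) auto
    then show ?thesis
      using assms by (simp add: sum.delta finite_exponents)
  qed
  then show ?thesis
    unfolding polynomial_of_degree_le_def
    by (intro exI[of _ "\<lambda>e'. if e' = e then 1 else 0"] allI)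
qed

lemma polynomial_of_degree_le_add:
  assumes "polynomial_of_degree_le k f" "polynomial_of_degree_le k g"
  shows "polynomial_of_degree_le k (\<lambda>x. f x + g x)"
proof -
  obtain c where "\<forall>x. f x = (\<Sum>e | (\<Sum>i\<in>UNIV. e i) \<le> k. c e * (\<Prod>i\<in>UNIV. (x $ i) ^ e i))"
    using assms(1) unfolding polynomial_of_degree_le_def by blast
  moreover obtain c' where "\<forall>x. g x = (\<Sum>e | (\<Sum>i\<in>UNIV. e i) \<le> k. c' e * (\<Prod>i\<in>UNIV. (x $ i) ^ e i))"
    using assms(2) unfolding polynomial_of_degree_le_def by blast
  ultimately have "\<forall>x. f x + g x =
      (\<Sum>e | (\<Sum>i\<in>UNIV. e i) \<le> k. (c e + c' e) * (\<Prod>i\<in>UNIV. (x $ i) ^ e i))"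
    by (simp add: sum.distrib distrib_right)
  then show ?thesis
    unfolding polynomial_of_degree_le_def by (intro exI[of _ "\<lambda>e. c e + c' e"])
qed

lemma polynomial_of_degree_le_cmult:
  assumes "polynomial_of_degree_le k f"
  shows "polynomial_of_degree_le k (\<lambda>x. a * f x)"
proof -
  obtain c where "\<forall>x. f x = (\<Sum>e | (\<Sum>i\<in>UNIV. e i) \<le> k. c e * (\<Prod>i\<in>UNIV. (x $ i) ^ e i))"
    using assms unfolding polynomial_of_degree_le_def by blast
  then have "\<forall>x. a * f x = (\<Sum>e | (\<Sum>i\<in>UNIV. e i) \<le> k. (a * c e) * (\<Prod>i\<in>UNIV. (x $ i) ^ e i))"
    by (simp add: sum_distrib_left mult.assoc)
  then show ?thesis
    unfolding polynomial_of_degree_le_def by (intro exI[of _ "\<lambda>e. a * c e"])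
qed

lemma polynomial_of_degree_le_const: "polynomial_of_degree_le k (\<lambda>x. a)"
  using polynomial_of_degree_le_cmult[OF polynomial_of_degree_le_monomial[of "\<lambda>_. 0" k], of a]
  by simp

lemma polynomial_of_degree_le_sum:
  assumes "\<And>j. j \<in> J \<Longrightarrow> polynomial_of_degree_le k (f j)"
  shows "polynomial_of_degree_le k (\<lambda>x. \<Sum>j\<in>J. f j x)"
  using assms
\<comment> \<open>A sum over an infinite \<open>J\<close> has the default value 0, so that case,
  like the empty one, reduces to a constant.\<close>
proof (induction J rule: infinite_finite_induct)
  case (insert j J)
  then show ?case by (simp add: polynomial_of_degree_le_add)
qed (simp_all add: polynomial_of_degree_le_const)

text \<open>Multiplying monomials adds their exponents. Different pairs \<open>e\<close>,
  \<open>e'\<close> may yield the same monomial, so the product is kept as a double sum and closure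
  under sums replaces the explicit convolution of coefficients.\<close>

lemma polynomial_of_degree_le_mult:
  fixes f g :: "real ^ 'n \<Rightarrow> real"
  assumes "polynomial_of_degree_le k f" "polynomial_of_degree_le l g"
  shows "polynomial_of_degree_le (k + l) (\<lambda>x. f x * g x)"
proof -
  let ?m = "\<lambda>e (x :: real ^ 'n). \<Prod>i\<in>UNIV. (x $ i) ^ e i"
  obtain c where c: "\<And>x. f x = (\<Sum>e | (\<Sum>i\<in>UNIV. e i) \<le> k. c e * ?m e x)"
    using assms(1) unfolding polynomial_of_degree_le_def by blast
  obtain c' where c': "\<And>x. g x = (\<Sum>e | (\<Sum>i\<in>UNIV. e i) \<le> l. c' e * ?m e x)"
    using assms(2) unfolding polynomial_of_degree_le_def by blast
  have "f x * g x = (\<Sum>e | (\<Sum>i\<in>UNIV. e i) \<le> k. \<Sum>e' | (\<Sum>i\<in>UNIV. e' i) \<le> l.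
      (c e * c' e') * ?m (\<lambda>i. e i + e' i) x)" for x
    unfolding c c' sum_product by (simp add: power_add prod.distrib mult_ac)
  moreover have "polynomial_of_degree_le (k + l) (\<lambda>x. \<Sum>e | (\<Sum>i\<in>UNIV. e i) \<le> k.
      \<Sum>e' | (\<Sum>i\<in>UNIV. e' i) \<le> l. (c e * c' e') * ?m (\<lambda>i. e i + e' i) x)"
    by (intro polynomial_of_degree_le_sum polynomial_of_degree_le_cmult
        polynomial_of_degree_le_monomial) (simp add: sum.distrib add_mono)
  ultimately show ?thesis by simp
qed

lemma polynomial_of_degree_le_power:
  assumes "polynomial_of_degree_le k f"
  shows "polynomial_of_degree_le (n * k) (\<lambda>x. f x ^ n)"
  by (induction n) (simp_all add: polynomial_of_degree_le_const polynomial_of_degree_le_mult assms)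

text \<open>Multiply by the constant 1, regarded as a polynomial of degree at most
  \<open>l - k\<close>.\<close>

lemma polynomial_of_degree_le_mono:
  assumes "polynomial_of_degree_le k f" "k \<le> l"
  shows "polynomial_of_degree_le l f"
  using polynomial_of_degree_le_mult[OF assms(1) polynomial_of_degree_le_const[of "l - k" 1]] assms(2)
  by simp

lemma polynomial_of_degree_le_inner: "polynomial_of_degree_le 1 (\<lambda>x :: real ^ 'n. a \<bullet> x)"
proof -
  \<comment> \<open>A coordinate is the monomial whose exponent vector is the indicator of
    \<open>i\<close>.\<close>
  have coord: "(\<Prod>j\<in>UNIV. (x $ j) ^ (if j = i then 1 else 0)) = x $ i" for x :: "real ^ 'n" and i
  proof -
    have "(\<Prod>j\<in>UNIV. (x $ j) ^ (if j = i then 1 else 0)) = (\<Prod>j\<in>UNIV. if j = i then x $ j else 1)"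
      by (rule prod.cong) auto
    then show ?thesis by simp
  qed
  have "polynomial_of_degree_le 1 (\<lambda>x :: real ^ 'n. x $ i)" for i
  proof -
    have "polynomial_of_degree_le 1
        (\<lambda>x :: real ^ 'n. \<Prod>j\<in>UNIV. (x $ j) ^ (if j = i then 1 else 0))"
      by (rule polynomial_of_degree_le_monomial) simp
    then show ?thesis unfolding coord .
  qed
  then show ?thesis
    unfolding inner_vec_def inner_real_def
    by (intro polynomial_of_degree_le_sum polynomial_of_degree_le_cmult)
qed

text \<open>Sphere measure is Lebesgue measure on the ball seen through radial projection. A nonzero
  value of \<open>f\<close> on the sphere would persist on a nonempty open set of the ball, which
  has positive volume.\<close>

lemma AE_sphere_measure_continuous_eq_0:
  fixes f :: "real ^ 'n \<Rightarrow> real"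
  assumes cont: "continuous_on UNIV f"
    and AE: "AE x in sphere_measure. f x = 0"
    and x: "norm x = 1"
  shows "f x = 0"
proof (rule ccontr)
  assume fx: "f x \<noteq> 0"
  let ?B = "ball 0 1 :: (real ^ 'n) set"
  \<comment> \<open>The origin is removed because radial projection is discontinuous there; this
    makes \<open>?U\<close> open.\<close>
  let ?U = "{y \<in> ?B - {0}. f (y /\<^sub>R norm y) \<noteq> 0}"
  have [measurable]: "f \<in> borel_measurable borel"
    using cont by (rule borel_measurable_continuous_onI)
  have B: "emeasure lborel ?B \<noteq> 0" "emeasure lborel ?B < \<infinity>"
    using open_not_negligible[of ?B] negligible_iff_emeasure0[of ?B] emeasure_bounded_finite[of ?B]
    by auto
  have "AE y in uniform_measure lborel ?B. f (y /\<^sub>R norm y) = 0"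
    using AE unfolding sphere_measure_def by (subst (asm) AE_distr_iff) auto
  then have "AE y in lborel. y \<in> ?B \<longrightarrow> f (y /\<^sub>R norm y) = 0"
    by (subst (asm) AE_uniform_measure) (use B in auto)
  then have null: "AE y in lborel. y \<notin> ?U"
    by eventually_elim auto
  have U: "open ?U"
  proof -
    have "continuous_on (?B - {0}) (\<lambda>y. f (y /\<^sub>R norm y))"
      by (rule continuous_on_compose2[OF cont]) (auto intro!: continuous_intros)
    then have "open ((?B - {0}) \<inter> (\<lambda>y. f (y /\<^sub>R norm y)) -` (- {0}))"
      by (rule continuous_open_preimage) auto
    also have "(?B - {0}) \<inter> (\<lambda>y. f (y /\<^sub>R norm y)) -` (- {0}) = ?U" by auto
    finally show ?thesis .
  qed
  \<comment> \<open>The unit vector \<open>x\<close> lies outside the open ball; its half lies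
    inside and projects back to \<open>x\<close>.\<close>
  have "x /\<^sub>R 2 \<in> ?U"
    using x fx by auto
  then have "?U \<noteq> {}" by blast
  then have "\<not> negligible ?U"
    by (rule open_not_negligible[OF U])
  then have "emeasure lborel ?U \<noteq> 0"
    using U by (subst (asm) negligible_iff_emeasure0) simp_all
  moreover have "?U \<in> sets lborel"
    using U by simp
  ultimately show False
    using AE_iff_measurable[of ?U lborel "\<lambda>y. y \<notin> ?U"] null by auto
qed

text \<open>The real zeros of \<open>t\<^sup>2 * (1 - t\<^sup>2)\<^sup>2\<close> are exactly 0, 1
  and -1, so the value condition can be turned into \<open>f = 0\<close> on \<open>D\<close> and
  recovered from \<open>f = 0\<close> on the sphere.\<close>

lemma minimal_type_sphere:
  fixes D :: "(real ^ 'n) set"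
  assumes D: "spherical_design 7 D"
    and \<alpha>: "\<And>x. x \<in> D \<Longrightarrow> \<alpha> \<bullet> x \<in> {0, 1, -1}"
    and x: "norm x = 1"
  shows "\<alpha> \<bullet> x \<in> {0, 1, -1}"
proof -
  \<comment> \<open>The form \<open>1 + (-1) * ...\<close> lets the closure rules for sums and
    scalar multiples apply directly.\<close>
  define f where "f = (\<lambda>y. (\<alpha> \<bullet> y)\<^sup>2 * (1 + (-1) * (\<alpha> \<bullet> y)\<^sup>2)\<^sup>2)"
  interpret prob_space "sphere_measure :: (real ^ 'n) measure"
    by (rule prob_space_sphere_measure)
  have cont: "continuous_on UNIV f"
    unfolding f_def by (intro continuous_intros)
  have pos: "f y \<ge> 0" for y
    unfolding f_def by simp
  have sq: "polynomial_of_degree_le 2 (\<lambda>y. (\<alpha> \<bullet> y)\<^sup>2)"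
    using polynomial_of_degree_le_power[OF polynomial_of_degree_le_inner, of 2] by simp
  have "polynomial_of_degree_le (2 + 2 * 2) f"
    unfolding f_def
    by (intro polynomial_of_degree_le_mult polynomial_of_degree_le_power polynomial_of_degree_le_add
        polynomial_of_degree_le_cmult polynomial_of_degree_le_const sq)
  then have "polynomial_of_degree_le 7 f"
    by (rule polynomial_of_degree_le_mono) simp
  then have "(\<integral>y. f y \<partial>sphere_measure) = (\<Sum>y\<in>D. f y) / real (card D)"
    using D unfolding spherical_design_def by blast
  also have "(\<Sum>y\<in>D. f y) = 0"
    using \<alpha> by (intro sum.neutral) (auto simp: f_def power2_eq_1_iff)
  finally have int0: "(\<integral>y. f y \<partial>sphere_measure) = 0" by simp
  \<comment> \<open>Integrability must be shown first: a non-integrable function also has integral 0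
    by convention. A bound on the compact sphere suffices, since the measure is concentrated
    there.\<close>
  have "bounded (f ` sphere 0 1)"
    by (intro compact_imp_bounded compact_continuous_image continuous_on_subset[OF cont]) auto
  then obtain b where b: "\<And>y. y \<in> sphere 0 1 \<Longrightarrow> norm (f y) \<le> b"
    unfolding bounded_iff by blast
  have "AE y in sphere_measure. norm (f y) \<le> b"
    using AE_sphere_measure by eventually_elim (rule b)
  moreover have "f \<in> borel_measurable sphere_measure"
    using borel_measurable_continuous_onI[OF cont] by (simp add: sphere_measure_def)
  ultimately have "integrable sphere_measure f"
    by (rule integrable_const_bound)
  then have "AE y in sphere_measure. f y = 0"
    using int0 pos by (simp add: integral_nonneg_eq_0_iff_AE)
  then have "f x = 0"
    using AE_sphere_measure_continuous_eq_0[OF cont] x by blast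
  then show ?thesis
    by (auto simp: f_def power2_eq_1_iff)
qed

theorem theorem4p3:
  fixes D :: "(real ^ 'n) set"
  assumes "CARD('n) > 1"
    and "tight_spherical_7_design D"
  shows "\<not> minimal_type D"
proof
  assume "minimal_type D"
  then obtain \<alpha> where "\<alpha> \<noteq> 0" and "\<And>x. x \<in> D \<Longrightarrow> \<alpha> \<bullet> x \<in> {0, 1, -1}"
    unfolding minimal_type_def by blast
  then have sphere: "\<alpha> \<bullet> x \<in> {0, 1, -1}" if "norm x = 1" for x
    using minimal_type_sphere that assms(2) unfolding tight_spherical_7_design_def by blast
  have "norm \<alpha> = 1"
  proof -
    \<comment> \<open>The normalized \<open>\<alpha>\<close> is a unit vector whose inner product
      with \<open>\<alpha>\<close> is \<open>norm \<alpha>\<close>.\<close>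
    have "norm \<alpha> \<in> {0, 1, -1}"
      using sphere[of "\<alpha> /\<^sub>R norm \<alpha>"] \<open>\<alpha> \<noteq> 0\<close>
      by (simp add: dot_square_norm power2_eq_square flip: mult.assoc)
    then show ?thesis
      using \<open>\<alpha> \<noteq> 0\<close> norm_ge_zero[of \<alpha>] by auto
  qed
  obtain w :: "real ^ 'n" where "w \<noteq> 0" "orthogonal \<alpha> w"
    using orthogonal_to_vector_exists[of \<alpha>] assms(1) by auto
  define v where "v = w /\<^sub>R norm w"
  have v: "norm v = 1" "\<alpha> \<bullet> v = 0"
    using \<open>w \<noteq> 0\<close> \<open>orthogonal \<alpha> w\<close> by (simp_all add: v_def orthogonal_def)
  \<comment> \<open>The triple 3, 4, 5 gives a unit vector in the plane of the orthonormal pair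
    \<open>\<alpha>\<close>, \<open>v\<close> whose inner product with \<open>\<alpha>\<close> is
    the forbidden value 3/5.\<close>
  let ?x = "(3/5) *\<^sub>R \<alpha> + (4/5) *\<^sub>R v"
  have "?x \<bullet> ?x = 1"
    using v \<open>norm \<alpha> = 1\<close> by (simp add: inner_add_left inner_add_right inner_commute[of v \<alpha>] norm_eq_1)
  then have "norm ?x = 1"
    by (simp add: norm_eq_1)
  moreover have "\<alpha> \<bullet> ?x = 3/5"
    using v \<open>norm \<alpha> = 1\<close> by (simp add: inner_add_right norm_eq_1)
  ultimately show False
    using sphere[of ?x] by simp
qed

end
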